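(* Consider the adversarial reinforcement learning problem described in the context, with separable reward $r_c(x,u)=q_c(x)-g_c(u)$ and with the dynamics subject to an adversarial action disturbance $\xi_u$, $$\dot x=f_c(x,u,\xi_u)=a(x;\theta)+B(x;\theta)\,\big(u+\xi_u\big),$$ where the disturbance has bounded signal energy, i.e. the admissible set $\Omega_E$ consists of all vectors $\xi$ (of the same dimension as $u$) with $\|\xi\|_2\le\alpha$. Then the optimal continuous-time policy $\pi$ and the optimal action disturbance $\xi_u$ are described by $$\pi(x)=\nabla\tilde g\big(B(x)^{T}\nabla_xV\big),\qquad \xi_u=-\alpha\,\frac{B(x)^{T}\nabla_xV}{\|B(x)^{T}\nabla_xV\|_2}.$$
   Context: Setting: $x$ is the state, $u$ the action, $\theta$ the system parameters, $a$ the non-linear drift and $B$ the non-linear control matrix, so that the deterministic continuous-time dynamics are non-linear in $x$ and affine in $u$; $B(x)$ abbreviates $B(x;\theta)$. The reward is $r_c(x,u)=q_c(x)-g_c(u)$, with state reward $q_c$ and action cost $g_c$ (also written $g$) that is non-linear, positive definite and strictly convex. $\tilde g$ is the convex conjugate of the action cost; its gradient is the inverse of the gradient of $g$, $\nabla\tilde g=[\nabla g]^{-1}$. Problem: the policy maximizes and the adversary minimizes the discounted reward, $$\max_{u}\ \inf_{\xi\in\Omega}\ \int_0^\infty \exp(-\rho t)\, r_c(x_t,u_t)\,dt,\qquad x(t)=x_0+\int_0^t f_c(x_\tau,u_\tau,\xi_\tau)\,d\tau,$$ with discounting constant $\rho\in(0,\infty]$. Policy and adversary are stationary and Markovian (deterministic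 functions of the state). The problem is treated by value iteration: given the current value function $V$, the next value target is $$V_{\mathrm{tar}}(x)=\max_u\ \inf_{\xi\in\Omega}\ r(x,u)+\gamma V\big(f(x,u,\xi)\big),$$ where $r$, $\gamma=\exp(-\rho\,\Delta t)$ and $f$ are the reward, discount factor and transition for time step $\Delta t$ corresponding to $r_c$, $\rho$ and $f_c$. The optimal continuous-time policy and disturbance are the action and disturbance solving this max-min problem in the continuous-time limit $\Delta t\to0$. $\nabla_xV$ denotes the gradient of $V$ with respect to the state, evaluated at $x$.
   Formalization: The discounting constant ρ is taken finite (at ρ = ∞ the value function drops out and the policy formula fails), and the disturbance is claimed to be given uniquely by the formula only at states where B(x)^T∇V ≠ 0, since the quotient is undefined elsewhere. *)

theory Defs
  imports "HOL-Analysis.Analysis"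
begin

definition gradient :: "('a::real_inner \<Rightarrow> real) \<Rightarrow> 'a \<Rightarrow> 'a" where
  "gradient f x = (THE D. GDERIV f x :> D)"

definition positive_definite :: "('a::real_vector \<Rightarrow> real) \<Rightarrow> bool" where
  "positive_definite g \<longleftrightarrow> g 0 = 0 \<and> (\<forall>u. u \<noteq> 0 \<longrightarrow> g u > 0)"

definition strictly_convex :: "('a::real_vector \<Rightarrow> real) \<Rightarrow> bool" where
  "strictly_convex g \<longleftrightarrow>
     (\<forall>u v t. u \<noteq> v \<longrightarrow> 0 < t \<longrightarrow> t < 1 \<longrightarrow>
        g ((1 - t) *\<^sub>R u + t *\<^sub>R v) < (1 - t) * g u + t * g v)"

text \<open>
  The supremum is taken in the reals.  It is finite (and attained) at every \<open>w\<close> in the range of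
  the gradient of a differentiable convex \<open>g\<close>, hence everywhere if that gradient is onto.
\<close>
definition convex_conjugate :: "('a::real_inner \<Rightarrow> real) \<Rightarrow> 'a \<Rightarrow> real" where
  "convex_conjugate g w = (SUP u. w \<bullet> u - g u)"

definition separable_reward ::
  "('x \<Rightarrow> real) \<Rightarrow> ('u \<Rightarrow> real) \<Rightarrow> 'x \<Rightarrow> 'u \<Rightarrow> real" where
  "separable_reward q g x u = q x - g u"

definition action_disturbed_dynamics ::
  "(real^'n \<Rightarrow> 'p \<Rightarrow> real^'n) \<Rightarrow> (real^'n \<Rightarrow> 'p \<Rightarrow> real^'m^'n) \<Rightarrow> 'p
   \<Rightarrow> real^'n \<Rightarrow> real^'m \<Rightarrow> real^'m \<Rightarrow> real^'n" where
  "action_disturbed_dynamics a B \<theta> x u \<xi> = a x \<theta> + B x \<theta> *v (u + \<xi>)"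

definition energy_set :: "real \<Rightarrow> (real^'m) set" where
  "energy_set \<alpha> = {\<xi>. norm \<xi> \<le> \<alpha>}"

text \<open>
  \<open>u\<close> maximises the worst case over \<open>\<Omega>\<close>, and \<open>\<xi>\<close> is a worst case for \<open>u\<close>.  The infimum is taken in
  the extended reals, so that actions with unbounded worst case get the value \<open>-\<infinity>\<close>.
\<close>
definition solves_maxmin :: "'c set \<Rightarrow> ('u \<Rightarrow> 'c \<Rightarrow> real) \<Rightarrow> 'u \<Rightarrow> 'c \<Rightarrow> bool" where
  "solves_maxmin \<Omega> J u \<xi> \<longleftrightarrow>
     is_arg_max (\<lambda>u'. INF \<xi>'\<in>\<Omega>. ereal (J u' \<xi>')) (\<lambda>_. True) u \<and>
     is_arg_min (J u) (\<lambda>\<xi>'. \<xi>' \<in> \<Omega>) \<xi>"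

text \<open>
  A family of rewards \<open>r h\<close> and transitions \<open>f h\<close> corresponds to the reward rate \<open>rc\<close> and the
  vector field \<open>fc\<close> if it reproduces them to first order in the time step \<open>h\<close>, uniformly for bounded
  actions and admissible disturbances.  The Euler scheme below is the standard instance.
\<close>
definition discretizes ::
  "'c set \<Rightarrow> ('x \<Rightarrow> 'u \<Rightarrow> real) \<Rightarrow> ('x \<Rightarrow> 'u \<Rightarrow> 'c \<Rightarrow> 'x)
   \<Rightarrow> (real \<Rightarrow> 'x \<Rightarrow> 'u \<Rightarrow> real)
   \<Rightarrow> (real \<Rightarrow> 'x::real_normed_vector \<Rightarrow> 'u::real_normed_vector \<Rightarrow> 'c \<Rightarrow> 'x) \<Rightarrow> bool" where
  "discretizes \<Omega> rc fc r f \<longleftrightarrow>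
     (\<forall>x U. bounded U \<longrightarrow>
        uniform_limit U (\<lambda>h u. r h x u / h) (rc x) (at_right 0) \<and>
        uniform_limit (U \<times> \<Omega>)
          (\<lambda>h (u, \<xi>). (f h x u \<xi> - x) /\<^sub>R h) (\<lambda>(u, \<xi>). fc x u \<xi>) (at_right 0))"

lemma discretizes_euler:
  "discretizes \<Omega> rc fc (\<lambda>h x u. h * rc x u) (\<lambda>h x u \<xi>. x + h *\<^sub>R fc x u \<xi>)"
proof -
  have *: "\<forall>\<^sub>F h in at_right (0::real). P h" if "\<And>h. h > 0 \<Longrightarrow> P h" for P
    using eventually_at_right_less[of "0::real"] by (rule eventually_mono) (rule that)
  show ?thesis
    unfolding discretizes_def uniform_limit_iff
    by (intro allI impI conjI *) auto
qed

text \<open>The value target of a state \<open>x\<close> is the max-min value of \<open>lookahead r f \<rho> V h x\<close>.\<close>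
definition lookahead ::
  "(real \<Rightarrow> 'x \<Rightarrow> 'u \<Rightarrow> real) \<Rightarrow> (real \<Rightarrow> 'x \<Rightarrow> 'u \<Rightarrow> 'c \<Rightarrow> 'x) \<Rightarrow> real \<Rightarrow> ('x \<Rightarrow> real)
   \<Rightarrow> real \<Rightarrow> 'x \<Rightarrow> 'u \<Rightarrow> 'c \<Rightarrow> real" where
  "lookahead r f \<rho> V h x u \<xi> = r h x u + exp (- \<rho> * h) * V (f h x u \<xi>)"

definition value_target ::
  "'c set \<Rightarrow> (real \<Rightarrow> 'x \<Rightarrow> 'u \<Rightarrow> real) \<Rightarrow> (real \<Rightarrow> 'x \<Rightarrow> 'u \<Rightarrow> 'c \<Rightarrow> 'x) \<Rightarrow> real \<Rightarrow> ('x \<Rightarrow> real)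
   \<Rightarrow> real \<Rightarrow> 'x \<Rightarrow> ereal" where
  "value_target \<Omega> r f \<rho> V h x = (SUP u. INF \<xi>\<in>\<Omega>. ereal (lookahead r f \<rho> V h x u \<xi>))"

lemma value_target_eq:
  assumes "solves_maxmin \<Omega> (lookahead r f \<rho> V h x) u \<xi>"
  shows "value_target \<Omega> r f \<rho> V h x = ereal (lookahead r f \<rho> V h x u \<xi>)"
proof (rule antisym)
  have inf: "(INF \<xi>'\<in>\<Omega>. ereal (lookahead r f \<rho> V h x u \<xi>')) = ereal (lookahead r f \<rho> V h x u \<xi>)"
    using assms unfolding solves_maxmin_def is_arg_min_linorder
    by (auto intro!: antisym INF_lower INF_greatest)
  show "value_target \<Omega> r f \<rho> V h x \<le> ereal (lookahead r f \<rho> V h x u \<xi>)"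
    using assms unfolding value_target_def solves_maxmin_def is_arg_max_linorder inf
    by (auto intro!: SUP_least)
  show "ereal (lookahead r f \<rho> V h x u \<xi>) \<le> value_target \<Omega> r f \<rho> V h x"
    unfolding value_target_def inf[symmetric] by (rule SUP_upper) simp
qed

text \<open>
  As \<open>h\<close> tends to \<open>0\<close> the objective \<open>lookahead r f \<rho> V h x u \<xi>\<close> itself degenerates to the constant \<open>V x\<close>.
  Subtracting \<open>V x\<close> and dividing by \<open>h > 0\<close> changes neither the maximising actions nor the minimising
  disturbances of the problem for step \<open>h\<close>, and the resulting objective has a nontrivial limit \<open>J\<close>.
  Convergence is required to be uniform for bounded actions and admissible disturbances, so that the
  worst case over \<open>\<Omega>\<close> converges as well.
\<close>
definition ct_limit_objective ::
  "'c set \<Rightarrow> (real \<Rightarrow> 'x \<Rightarrow> 'u \<Rightarrow> real) \<Rightarrow> (real \<Rightarrow> 'x \<Rightarrow> 'u \<Rightarrow> 'c \<Rightarrow> 'x) \<Rightarrow> real \<Rightarrow> ('x \<Rightarrow> real)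
   \<Rightarrow> 'x \<Rightarrow> ('u::real_normed_vector \<Rightarrow> 'c \<Rightarrow> real) \<Rightarrow> bool" where
  "ct_limit_objective \<Omega> r f \<rho> V x J \<longleftrightarrow>
     (\<forall>U. bounded U \<longrightarrow>
        uniform_limit (U \<times> \<Omega>)
          (\<lambda>h (u, \<xi>). (lookahead r f \<rho> V h x u \<xi> - V x) / h) (\<lambda>(u, \<xi>). J u \<xi>) (at_right 0))"

lemma INF_ereal_le_iff:
  "(INF \<xi>\<in>\<Omega>. ereal (F \<xi>)) \<le> (INF \<xi>\<in>\<Omega>. ereal (G \<xi>)) \<longleftrightarrow>
     (\<forall>z. (\<forall>\<xi>\<in>\<Omega>. z \<le> F \<xi>) \<longrightarrow> (\<forall>\<xi>\<in>\<Omega>. z \<le> G \<xi>))"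
  (is "?L \<longleftrightarrow> ?R")
proof
  assume L: ?L
  show ?R
  proof (intro allI impI)
    fix z assume "\<forall>\<xi>\<in>\<Omega>. z \<le> F \<xi>"
    then have "ereal z \<le> (INF \<xi>\<in>\<Omega>. ereal (F \<xi>))" by (intro INF_greatest) simp
    with L have "ereal z \<le> (INF \<xi>\<in>\<Omega>. ereal (G \<xi>))" by (rule order_trans[rotated])
    then show "\<forall>\<xi>\<in>\<Omega>. z \<le> G \<xi>" by (simp add: le_INF_iff)
  qed
next
  assume R: ?R
  show ?L
  proof (rule INF_greatest)
    fix \<xi> assume \<xi>: "\<xi> \<in> \<Omega>"
    show "(INF \<xi>\<in>\<Omega>. ereal (F \<xi>)) \<le> ereal (G \<xi>)"
    proof (rule dense_le)
      fix y assume y: "y < (INF \<xi>\<in>\<Omega>. ereal (F \<xi>))"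
      show "y \<le> ereal (G \<xi>)"
      proof (cases y)
        case (real z)
        then have "\<forall>\<xi>\<in>\<Omega>. z \<le> F \<xi>" using y by (auto dest: less_INF_D)
        then show ?thesis using R \<xi> real by auto
      qed (use y in auto)
    qed
  qed
qed

lemma solves_maxmin_rescale:
  fixes c h :: real
  assumes h: "h > 0"
  shows "solves_maxmin \<Omega> (\<lambda>u \<xi>. (J u \<xi> - c) / h) u \<xi> \<longleftrightarrow> solves_maxmin \<Omega> J u \<xi>"
proof -
  have "(\<forall>z. (\<forall>\<xi>\<in>\<Omega>. z \<le> (J u \<xi> - c) / h) \<longrightarrow> (\<forall>\<xi>\<in>\<Omega>. z \<le> (J v \<xi> - c) / h)) \<longleftrightarrow>
        (\<forall>z. (\<forall>\<xi>\<in>\<Omega>. z \<le> J u \<xi>) \<longrightarrow> (\<forall>\<xi>\<in>\<Omega>. z \<le> J v \<xi>))" (is "?L \<longleftrightarrow> ?R") for u v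
  proof
    assume L: ?L
    show ?R
    proof (intro allI)
      fix z
      show "(\<forall>\<xi>\<in>\<Omega>. z \<le> J u \<xi>) \<longrightarrow> (\<forall>\<xi>\<in>\<Omega>. z \<le> J v \<xi>)"
        using L[rule_format, of "(z - c) / h"] h by (simp add: divide_le_cancel)
    qed
  next
    assume R: ?R
    have *: "z \<le> (y - c) / h \<longleftrightarrow> z * h + c \<le> y" for z y
      using h by (simp add: field_simps)
    show ?L unfolding * using R by blast
  qed
  moreover have "(J u \<xi> - c) / h < (J u \<xi>' - c) / h \<longleftrightarrow> J u \<xi> < J u \<xi>'" for u \<xi> \<xi>'
    using h by (simp add: divide_less_cancel)
  ultimately show ?thesis
    unfolding solves_maxmin_def is_arg_max_def is_arg_min_def not_le[symmetric] INF_ereal_le_iff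
    by (simp add: not_le)
qed

text \<open>Policy and adversary are deterministic functions of the state.\<close>
definition ct_optimal ::
  "'c set \<Rightarrow> (real \<Rightarrow> 'x \<Rightarrow> 'u \<Rightarrow> real) \<Rightarrow> (real \<Rightarrow> 'x \<Rightarrow> 'u \<Rightarrow> 'c \<Rightarrow> 'x) \<Rightarrow> real \<Rightarrow> ('x \<Rightarrow> real)
   \<Rightarrow> ('x \<Rightarrow> 'u::real_normed_vector) \<Rightarrow> ('x \<Rightarrow> 'c) \<Rightarrow> bool" where
  "ct_optimal \<Omega> r f \<rho> V \<pi> \<xi> \<longleftrightarrow>
     (\<forall>x. \<exists>J. ct_limit_objective \<Omega> r f \<rho> V x J \<and> solves_maxmin \<Omega> J (\<pi> x) (\<xi> x))"

end

theory Submission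
  imports Defs
begin

text \<open>
  To first order in the time step the objective is an additive constant plus
  \<open>w \<bullet> u - g u + w \<bullet> \<xi>\<close> with \<open>w = B\<^sup>T \<nabla>V\<close>, so action and disturbance decouple.  Over the ball of
  radius \<open>\<alpha>\<close>, Cauchy--Schwarz gives the minimal value \<open>- \<alpha> \<parallel>w\<parallel>\<close> of \<open>w \<bullet> \<xi>\<close>, attained only at
  \<open>- \<alpha> w / \<parallel>w\<parallel>\<close> if \<open>w \<noteq> 0\<close>; the strictly concave \<open>w \<bullet> u - g u\<close> is maximal exactly where
  \<open>\<nabla>g u = w\<close>.  That this \<open>u\<close> is the gradient of the conjugate at \<open>w\<close> follows from
  \<open>0 \<le> g\<^sup>*(w') - g\<^sup>*(w) - (w' - w) \<bullet> u \<le> (w' - w) \<bullet> (u' - u)\<close> for \<open>w' = \<nabla>g u'\<close>, once the inverse of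
  \<open>\<nabla>g\<close> is known to be continuous.
\<close>

section \<open>Gradients on Euclidean spaces\<close>

lemma gradient_eqI:
  assumes "GDERIV f x :> D"
  shows "gradient f x = D"
proof -
  have "E = D" if "GDERIV f x :> E" for E
  proof -
    have "(\<lambda>h. h \<bullet> E) = (\<lambda>h. h \<bullet> D)"
      using has_derivative_unique[OF that[unfolded gderiv_def] assms[unfolded gderiv_def]] .
    then have "(E - D) \<bullet> E = (E - D) \<bullet> D" by meson
    then have "(E - D) \<bullet> (E - D) = 0" by (simp only: inner_diff_right)
    then show ?thesis by simp
  qed
  then show ?thesis
    unfolding gradient_def using assms by blast
qed

text \<open>Riesz representation in finite dimension: the coordinates of the representing vector are
  the values of the derivative on the basis.\<close>

lemma GDERIV_gradient:
  fixes f :: "'a::euclidean_space \<Rightarrow> real"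
  assumes "f differentiable (at x)"
  shows "GDERIV f x :> gradient f x"
proof -
  obtain F where F: "(f has_derivative F) (at x)"
    using assms unfolding differentiable_def by blast
  have lin: "linear F" using F by (rule has_derivative_linear)
  have "F = (\<lambda>h. h \<bullet> (\<Sum>b\<in>Basis. F b *\<^sub>R b))"
  proof
    fix h
    have "F h = F (\<Sum>b\<in>Basis. (h \<bullet> b) *\<^sub>R b)" by (simp add: euclidean_representation)
    also have "\<dots> = (\<Sum>b\<in>Basis. (h \<bullet> b) * F b)"
      by (simp add: linear_sum[OF lin] linear_cmul[OF lin])
    also have "\<dots> = h \<bullet> (\<Sum>b\<in>Basis. F b *\<^sub>R b)"
      by (simp add: inner_sum_right mult.commute)
    finally show "F h = h \<bullet> (\<Sum>b\<in>Basis. F b *\<^sub>R b)" .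
  qed
  with F have "GDERIV f x :> (\<Sum>b\<in>Basis. F b *\<^sub>R b)"
    unfolding gderiv_def by metis
  then show ?thesis using gradient_eqI by metis
qed

section \<open>Tangent inequalities for strictly convex functions\<close>

lemma strictly_convexD:
  assumes "strictly_convex g" "0 \<le> t" "t \<le> 1"
  shows "g (u + t *\<^sub>R (v - u)) \<le> g u + t * (g v - g u)"
proof (cases "u = v \<or> t = 0 \<or> t = 1")
  case False
  then have "g ((1 - t) *\<^sub>R u + t *\<^sub>R v) < (1 - t) * g u + t * g v"
    using assms unfolding strictly_convex_def by simp
  then show ?thesis by (simp add: algebra_simps)
qed auto

text \<open>Convexity bounds the difference quotients along the segment towards \<open>v\<close> by
  \<open>g v - g u\<close>. Letting the parameter tend to 0 from the right turns them into the
  directional derivative.\<close>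

lemma strictly_convex_ge_tangent:
  assumes g: "strictly_convex g" and D: "GDERIV g u :> D"
  shows "g u + D \<bullet> (v - u) \<le> g v"
proof -
  have "((\<lambda>t. g (u + t *\<^sub>R (v - u))) has_real_derivative D \<bullet> (v - u)) (at 0)"
  proof -
    have "(g has_derivative (\<lambda>h. h \<bullet> D)) (at (u + 0 *\<^sub>R (v - u)))"
      using D by (simp add: gderiv_def)
    then have "((\<lambda>t. g (u + t *\<^sub>R (v - u))) has_derivative (\<lambda>t. (t *\<^sub>R (v - u)) \<bullet> D)) (at 0)"
      by (rule has_derivative_compose[rotated]) (auto intro!: derivative_eq_intros)
    moreover have "(\<lambda>t. (t *\<^sub>R (v - u)) \<bullet> D) = (*) (D \<bullet> (v - u))"
      by (auto simp: inner_commute)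
    ultimately show ?thesis by (simp add: has_field_derivative_def)
  qed
  then have "((\<lambda>t. (g (u + t *\<^sub>R (v - u)) - g u) / t) \<longlongrightarrow> D \<bullet> (v - u)) (at_right 0)"
    by (auto simp: has_field_derivative_iff intro: filterlim_at_split[THEN iffD1, THEN conjunct2])
  moreover have "\<forall>\<^sub>F t in at_right 0. (g (u + t *\<^sub>R (v - u)) - g u) / t \<le> g v - g u"
    using eventually_at_right_real[OF zero_less_one]
    by eventually_elim (use strictly_convexD[OF g, of _ u v] in \<open>auto simp: field_simps\<close>)
  ultimately have "D \<bullet> (v - u) \<le> g v - g u"
    by (rule tendsto_upperbound) simp
  then show ?thesis by simp
qed

text \<open>The weak inequality at the midpoint, combined with the strict convexity inequality
  there, becomes strict at \<open>v\<close>.\<close>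

lemma strictly_convex_gt_tangent:
  assumes g: "strictly_convex g" and D: "GDERIV g u :> D" and "v \<noteq> u"
  shows "g u + D \<bullet> (v - u) < g v"
proof -
  let ?m = "(1/2) *\<^sub>R u + (1/2) *\<^sub>R v"
  have "?m - u = (1/2) *\<^sub>R (v - u)"
    by (simp add: algebra_simps flip: scaleR_left_distrib)
  then have "g u + (D \<bullet> (v - u)) / 2 \<le> g ?m"
    using strictly_convex_ge_tangent[OF g D, of ?m] by simp
  also have "g ?m < g u / 2 + g v / 2"
    using g[unfolded strictly_convex_def, rule_format, of u v "1/2"] \<open>v \<noteq> u\<close> by simp
  finally show ?thesis by simp
qed

section \<open>The convex conjugate and its gradient\<close>

text \<open>Equality case of the Fenchel-Young inequality: by the tangent inequality the supremum is
  attained at \<open>u\<close>, so its finiteness needs no separate argument.\<close>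

lemma convex_conjugate_eq:
  assumes "strictly_convex g" "GDERIV g u :> w"
  shows "convex_conjugate g w = w \<bullet> u - g u"
  unfolding convex_conjugate_def
proof (rule cSup_eq_maximum)
  fix y assume "y \<in> range (\<lambda>v. w \<bullet> v - g v)"
  then show "y \<le> w \<bullet> u - g u"
    using strictly_convex_ge_tangent[OF assms] by (auto simp: inner_diff_right algebra_simps)
qed auto

text \<open>If \<open>v\<close> were at distance at least \<open>e\<close> from \<open>u\<close>,
  convexity along the segment would force \<open>h v\<close> to exceed a linear bound set by its
  positive minimum on the compact sphere, whereas \<open>h v\<close> is at most
  \<open>norm (w' - w) * norm (v - u)\<close>.\<close>

lemma inverse_gradient_continuous:
  fixes g :: "'a::euclidean_space \<Rightarrow> real"
  assumes g: "strictly_convex g" and cont: "continuous_on UNIV g"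
    and D: "GDERIV g u :> w" and e: "e > 0"
  obtains d where "d > 0" "\<And>v w'. GDERIV g v :> w' \<Longrightarrow> norm (w' - w) < d \<Longrightarrow> norm (v - u) < e"
proof -
  \<comment> \<open>The Bregman divergence of \<open>g\<close> from \<open>u\<close>: zero at
    \<open>u\<close>, positive elsewhere.\<close>
  define h where "h v = g v - g u - w \<bullet> (v - u)" for v
  have "continuous_on (sphere u e) h"
    unfolding h_def by (intro continuous_intros continuous_on_subset[OF cont]) auto
  then obtain z0 where z0: "z0 \<in> sphere u e" "\<And>z. z \<in> sphere u e \<Longrightarrow> h z0 \<le> h z"
    using continuous_attains_inf[of "sphere u e" h] e by auto
  have "h z0 > 0"
    using strictly_convex_gt_tangent[OF g D, of z0] z0(1) e by (auto simp: h_def)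
  show ?thesis
  proof
    show "h z0 / e > 0" using \<open>h z0 > 0\<close> e by simp
    fix v w' assume D': "GDERIV g v :> w'" and w': "norm (w' - w) < h z0 / e"
    show "norm (v - u) < e"
    proof (rule ccontr)
      assume "\<not> norm (v - u) < e"
      then have ge: "norm (v - u) \<ge> e" by simp
      \<comment> \<open>This factor pulls \<open>v\<close> back along the segment to the sphere,
        where \<open>h z0\<close> is a lower bound.\<close>
      define t where "t = e / norm (v - u)"
      have t: "0 < t" "t \<le> 1" using ge e unfolding t_def by (auto simp: divide_simps)
      have tn: "t * norm (v - u) = e" using ge e unfolding t_def by auto
      have "u + t *\<^sub>R (v - u) \<in> sphere u e"
        using t tn by (simp add: dist_norm)
      then have "h z0 \<le> h (u + t *\<^sub>R (v - u))" by (rule z0(2))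
      also have "\<dots> \<le> t * h v"
        using strictly_convexD[OF g, of t u v] t by (simp add: h_def algebra_simps)
      \<comment> \<open>Tangent to \<open>g\<close> at \<open>v\<close>, evaluated at
        \<open>u\<close>.\<close>
      also have "h v \<le> (w' - w) \<bullet> (v - u)"
        using strictly_convex_ge_tangent[OF g D', of u]
        by (simp add: h_def inner_diff_left inner_diff_right)
      also have "\<dots> \<le> norm (w' - w) * norm (v - u)"
        by (rule norm_cauchy_schwarz)
      finally have "h z0 \<le> norm (w' - w) * (t * norm (v - u))" using t by (simp add: mult_ac)
      then show False using w' e by (simp add: tn field_simps)
    qed
  qed
qed

text \<open>Surjectivity makes every \<open>w'\<close> near \<open>w\<close> a gradient of
  \<open>g\<close>, so both conjugate values are explicit and the remainder can be estimated
  directly.\<close>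

lemma GDERIV_convex_conjugate:
  fixes g :: "'a::euclidean_space \<Rightarrow> real"
  assumes g: "strictly_convex g" and diff: "\<And>u. g differentiable (at u)"
    and surj: "surj (gradient g)" and D: "GDERIV g u :> w"
  shows "GDERIV (convex_conjugate g) w :> u"
proof -
  have cont: "continuous_on UNIV g"
    using diff by (auto intro!: continuous_at_imp_continuous_on differentiable_imp_continuous_within)
  show ?thesis
    unfolding gderiv_def has_derivative_at_alt
  proof (intro conjI allI impI)
    show "bounded_linear (\<lambda>h. h \<bullet> u)" by (rule bounded_linear_inner_left)
    fix e :: real assume "e > 0"
    then obtain d where d: "d > 0"
      "\<And>v w'. GDERIV g v :> w' \<Longrightarrow> norm (w' - w) < d \<Longrightarrow> norm (v - u) < e"
      using inverse_gradient_continuous[OF g cont D] by metis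
    have "norm (convex_conjugate g w' - convex_conjugate g w - (w' - w) \<bullet> u) \<le> e * norm (w' - w)"
      if w': "norm (w' - w) < d" for w'
    proof -
      obtain v where v: "GDERIV g v :> w'"
        using surj GDERIV_gradient[OF diff] by (metis surjD)
      note eq = convex_conjugate_eq[OF g v] convex_conjugate_eq[OF g D]
      let ?R = "convex_conjugate g w' - convex_conjugate g w - (w' - w) \<bullet> u"
      \<comment> \<open>The lower bound is the tangent inequality at \<open>v\<close> evaluated at
        \<open>u\<close>; the upper bound below is the one at \<open>u\<close> evaluated at
        \<open>v\<close>.\<close>
      have "0 \<le> ?R"
        using strictly_convex_ge_tangent[OF g v, of u]
        by (simp add: eq inner_diff_left inner_diff_right)
      moreover have "?R \<le> (w' - w) \<bullet> (v - u)"
        using strictly_convex_ge_tangent[OF g D, of v]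
        by (simp add: eq inner_diff_left inner_diff_right)
      moreover have "\<dots> \<le> norm (w' - w) * norm (v - u)"
        by (rule norm_cauchy_schwarz)
      moreover have "\<dots> \<le> norm (w' - w) * e"
        using d(2)[OF v w'] by (intro mult_left_mono) auto
      ultimately show ?thesis by (simp add: mult.commute)
    qed
    then show "\<exists>d>0. \<forall>w'. norm (w' - w) < d \<longrightarrow>
        norm (convex_conjugate g w' - convex_conjugate g w - (w' - w) \<bullet> u) \<le> e * norm (w' - w)"
      using d(1) by blast
  qed
qed

section \<open>Worst disturbances in the ball and the decoupled max-min problem\<close>

lemma inner_energy_set_ge:
  assumes "\<xi> \<in> energy_set \<alpha>"
  shows "- (\<alpha> * norm w) \<le> w \<bullet> \<xi>"
proof -
  have "\<bar>w \<bullet> \<xi>\<bar> \<le> norm w * norm \<xi>" by (rule Cauchy_Schwarz_ineq2)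
  also have "\<dots> \<le> norm w * \<alpha>"
    using assms by (intro mult_left_mono) (auto simp: energy_set_def)
  finally show ?thesis by (simp add: mult.commute)
qed

text \<open>The case \<open>w = 0\<close> is included: since \<open>inverse 0 = 0\<close>, the
  formula then yields the zero vector, which is admissible and attains the value 0.\<close>

lemma worst_disturbance:
  assumes "\<alpha> \<ge> 0"
  shows "- \<alpha> *\<^sub>R (w /\<^sub>R norm w) \<in> energy_set \<alpha>"
    and "w \<bullet> (- \<alpha> *\<^sub>R (w /\<^sub>R norm w)) = - (\<alpha> * norm w)"
  using assms
  by (cases "w = 0"; simp add: energy_set_def dot_square_norm power2_eq_square field_simps)
     (cases "w = 0"; simp add: dot_square_norm power2_eq_square field_simps)

text \<open>Equality case of Cauchy-Schwarz: the squared distance to the claimed minimiser is at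
  most \<open>\<alpha>\<^sup>2 - 2 * \<alpha>\<^sup>2 + \<alpha>\<^sup>2\<close>, that is,
  0.\<close>

lemma worst_disturbance_unique:
  fixes w :: "real^'m"
  assumes "\<xi> \<in> energy_set \<alpha>" "\<alpha> \<ge> 0" "w \<bullet> \<xi> = - (\<alpha> * norm w)" "w \<noteq> 0"
  shows "\<xi> = - \<alpha> *\<^sub>R (w /\<^sub>R norm w)"
proof -
  let ?v = "\<alpha> *\<^sub>R (w /\<^sub>R norm w)"
  have "(norm (\<xi> + ?v))\<^sup>2 = (norm \<xi>)\<^sup>2 + 2 * (\<xi> \<bullet> ?v) + (norm ?v)\<^sup>2"
    unfolding power2_norm_eq_inner inner_add_left inner_add_right
    using inner_commute[of ?v \<xi>] by linarith
  moreover have "\<xi> \<bullet> ?v = - \<alpha>\<^sup>2"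
    using assms by (simp add: inner_commute[of \<xi>] power2_eq_square)
  moreover have "norm ?v = \<alpha>" using assms by simp
  moreover have "(norm \<xi>)\<^sup>2 \<le> \<alpha>\<^sup>2"
    using assms by (auto simp: energy_set_def intro: power_mono)
  ultimately have "(norm (\<xi> + ?v))\<^sup>2 \<le> 0" by simp
  then have "\<xi> + ?v = 0" by simp
  then show ?thesis by (simp add: eq_neg_iff_add_eq_0)
qed

text \<open>An equivalence, so that it serves both optimality and uniqueness. The disturbance is
  characterised by its value because for \<open>w = 0\<close> every admissible one is a worst case.
  \<open>J\<close> is prescribed only on the ball, which is where a limit objective is
  determined.\<close>

lemma solves_maxmin_decoupled:
  fixes w :: "real^'m"
  assumes g: "strictly_convex g" and D: "GDERIV g u0 :> w" and \<alpha>: "\<alpha> \<ge> 0"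
    and J: "\<And>u \<xi>. \<xi> \<in> energy_set \<alpha> \<Longrightarrow> J u \<xi> = c + (w \<bullet> u - g u) + w \<bullet> \<xi>"
  shows "solves_maxmin (energy_set \<alpha>) J u \<xi> \<longleftrightarrow>
    u = u0 \<and> \<xi> \<in> energy_set \<alpha> \<and> w \<bullet> \<xi> = - (\<alpha> * norm w)"
proof -
  note wd = worst_disturbance[OF \<alpha>, of w]
  \<comment> \<open>The adversary costs the same \<open>\<alpha> * norm w\<close> whatever the
    action, so the outer problem is to maximise \<open>w \<bullet> v - g v\<close>.\<close>
  have inf: "(INF \<xi>'\<in>energy_set \<alpha>. ereal (J v \<xi>')) = ereal (c + (w \<bullet> v - g v) - \<alpha> * norm w)" for v
  proof (rule antisym)
    show "(INF \<xi>'\<in>energy_set \<alpha>. ereal (J v \<xi>')) \<le> ereal (c + (w \<bullet> v - g v) - \<alpha> * norm w)"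
      by (rule INF_lower2[OF wd(1)]) (simp only: J[OF wd(1)] wd(2), simp)
    show "ereal (c + (w \<bullet> v - g v) - \<alpha> * norm w) \<le> (INF \<xi>'\<in>energy_set \<alpha>. ereal (J v \<xi>'))"
      by (rule INF_greatest) (use inner_energy_set_ge[of _ \<alpha> w] in \<open>simp add: J\<close>)
  qed
  have max: "w \<bullet> v - g v < w \<bullet> u0 - g u0" if "v \<noteq> u0" for v
    using strictly_convex_gt_tangent[OF g D that] by (simp add: inner_diff_right)
  have le: "w \<bullet> v - g v \<le> w \<bullet> u0 - g u0" for v
    using max[of v] by (cases "v = u0") auto
  have "is_arg_max (\<lambda>u'. INF \<xi>'\<in>energy_set \<alpha>. ereal (J u' \<xi>')) (\<lambda>_. True) u \<longleftrightarrow> u = u0"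
    unfolding inf is_arg_max_linorder using max[of u] le by (cases "u = u0") (auto simp: not_le)
  moreover have "is_arg_min (J u) (\<lambda>\<xi>'. \<xi>' \<in> energy_set \<alpha>) \<xi> \<longleftrightarrow>
      \<xi> \<in> energy_set \<alpha> \<and> w \<bullet> \<xi> = - (\<alpha> * norm w)"
    unfolding is_arg_min_linorder
  proof (intro conj_cong refl iffI ballI allI impI)
    assume \<xi>: "\<xi> \<in> energy_set \<alpha>" and "\<forall>y. y \<in> energy_set \<alpha> \<longrightarrow> J u \<xi> \<le> J u y"
    with wd(1) have "w \<bullet> \<xi> \<le> w \<bullet> (- \<alpha> *\<^sub>R (w /\<^sub>R norm w))"
      by (auto simp: J simp del: inner_scaleR_right)
    then show "w \<bullet> \<xi> = - (\<alpha> * norm w)"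
      using inner_energy_set_ge[OF \<xi>, of w] unfolding wd(2) by simp
  next
    fix y :: "real^'m" assume "\<xi> \<in> energy_set \<alpha>" "w \<bullet> \<xi> = - (\<alpha> * norm w)" "y \<in> energy_set \<alpha>"
    then show "J u \<xi> \<le> J u y"
      using inner_energy_set_ge[of y \<alpha> w] by (simp add: J)
  qed
  ultimately show ?thesis unfolding solves_maxmin_def by blast
qed

section \<open>The continuous-time limit of the lookahead objective\<close>

text \<open>A uniform chain rule along varying directions \<open>y h z\<close>. The error splits
  into the first-order remainder of \<open>V\<close> and \<open>D (y h z - Y z)\<close>, each
  contributing at most \<open>e / 2\<close>.\<close>

lemma uniform_limit_difference_quotient:
  fixes V :: "'a::real_normed_vector \<Rightarrow> real"
  assumes V: "(V has_derivative D) (at x)"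
    and y: "uniform_limit S y Y (at_right 0)" and Y: "bounded (Y ` S)"
  shows "uniform_limit S (\<lambda>h z. (V (x + h *\<^sub>R y h z) - V x) / h) (\<lambda>z. D (Y z)) (at_right 0)"
proof -
  interpret D: bounded_linear D using V by (rule has_derivative_bounded_linear)
  obtain M where M: "M > 0" "\<And>z. z \<in> S \<Longrightarrow> norm (Y z) \<le> M"
    using Y unfolding bounded_pos by auto
  obtain K where K: "K > 0" "\<And>v. norm (D v) \<le> norm v * K"
    using D.pos_bounded by blast
  show ?thesis
  proof (rule uniform_limitI)
    fix e :: real assume e: "e > 0"
    \<comment> \<open>\<open>M + 1\<close> will bound \<open>norm (y h z)\<close>, so the remainder
      is at most \<open>e1 * (M + 1) = e / 2\<close>.\<close>
    define e1 where "e1 = e / (2 * (M + 1))"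
    have e1: "e1 > 0" using e M by (simp add: e1_def)
    obtain d where d: "d > 0"
      "\<And>v. norm (v - x) < d \<Longrightarrow> norm (V v - V x - D (v - x)) \<le> e1 * norm (v - x)"
      using V e1 unfolding has_derivative_at_alt by blast
    \<comment> \<open>For \<open>h < d1\<close> the displacement \<open>h *\<^sub>R y h z\<close>
      stays shorter than \<open>d\<close>.\<close>
    define d1 where "d1 = d / (M + 1)"
    have d1: "d1 > 0" using d M by (simp add: d1_def)
    have "\<forall>\<^sub>F h in at_right 0. h \<in> {0<..<d1}"
      using d1 by (rule eventually_at_right_real)
    \<comment> \<open>The 1 yields the bound \<open>M + 1\<close> on the directions;
      \<open>e / (2 * K)\<close> controls the linear part.\<close>
    moreover have "\<forall>\<^sub>F h in at_right 0. \<forall>z\<in>S. dist (y h z) (Y z) < min 1 (e / (2 * K))"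
      using e K by (intro uniform_limitD[OF y]) simp
    ultimately show "\<forall>\<^sub>F h in at_right 0. \<forall>z\<in>S. dist ((V (x + h *\<^sub>R y h z) - V x) / h) (D (Y z)) < e"
    proof eventually_elim
      case (elim h)
      show ?case
      proof
        fix z assume z: "z \<in> S"
        have h: "h > 0" "h < d1" using elim by auto
        have yY: "norm (y h z - Y z) < 1" "norm (y h z - Y z) < e / (2 * K)"
          using elim z by (auto simp: dist_norm)
        have yM: "norm (y h z) < M + 1"
          using yY(1) M(2)[OF z] norm_triangle_sub[of "y h z" "Y z"] by linarith
        have "h * norm (y h z) \<le> h * (M + 1)" using yM h by simp
        also have "\<dots> < d" using h M by (simp add: d1_def field_simps)
        finally have "norm (V (x + h *\<^sub>R y h z) - V x - D (h *\<^sub>R y h z)) \<le> e1 * (h * norm (y h z))"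
          using d(2)[of "x + h *\<^sub>R y h z"] h by simp
        then have "\<bar>(V (x + h *\<^sub>R y h z) - V x) / h - D (y h z)\<bar> \<le> e1 * norm (y h z)"
          using h by (simp add: D.scaleR field_simps abs_le_iff)
        also have "\<dots> \<le> e1 * (M + 1)" using yM e1 by simp
        also have "\<dots> = e / 2" using M by (simp add: e1_def field_simps)
        finally have 1: "\<bar>(V (x + h *\<^sub>R y h z) - V x) / h - D (y h z)\<bar> \<le> e / 2" .
        have "\<bar>D (y h z) - D (Y z)\<bar> \<le> norm (y h z - Y z) * K"
          using K(2)[of "y h z - Y z"] by (simp add: D.diff)
        also have "\<dots> < e / 2" using yY(2) K by (simp add: field_simps)
        finally show "dist ((V (x + h *\<^sub>R y h z) - V x) / h) (D (Y z)) < e"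
          using 1 unfolding dist_real_def by linarith
      qed
    qed
  qed
qed

text \<open>The rescaled objective splits into the reward rate, the discounted difference quotient
  of \<open>V\<close>, and \<open>(exp (- \<rho> * h) - 1) / h * V x\<close>; each converges
  uniformly, the last one to \<open>- \<rho> * V x\<close>.\<close>

lemma ct_limit_objective_discretizes:
  fixes rc :: "'x::real_inner \<Rightarrow> 'u::real_normed_vector \<Rightarrow> real"
  assumes disc: "discretizes \<Omega> rc fc r f" and V: "GDERIV V x :> D"
    and bdd: "\<And>U. bounded U \<Longrightarrow> bounded ((\<lambda>(u, \<xi>). fc x u \<xi>) ` (U \<times> \<Omega>))"
  shows "ct_limit_objective \<Omega> r f \<rho> V x (\<lambda>u \<xi>. rc x u + D \<bullet> fc x u \<xi> - \<rho> * V x)"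
  unfolding ct_limit_objective_def
proof (intro allI impI)
  fix U :: "'u set" assume U: "bounded U"
  let ?S = "U \<times> \<Omega>"
  \<comment> \<open>For \<open>h > 0\<close> the argument of \<open>V\<close> is just
    \<open>f h x u \<xi>\<close>, rewritten as a step of length \<open>h\<close> from
    \<open>x\<close>.\<close>
  let ?q = "\<lambda>h z. (V (x + h *\<^sub>R (case z of (u, \<xi>) \<Rightarrow> (f h x u \<xi> - x) /\<^sub>R h)) - V x) / h"
  let ?Q = "\<lambda>z. (case z of (u, \<xi>) \<Rightarrow> fc x u \<xi>) \<bullet> D"
  have "uniform_limit U (\<lambda>h u. r h x u / h) (rc x) (at_right 0)"
    using disc U unfolding discretizes_def by blast
  then have r: "uniform_limit ?S (\<lambda>h z. r h x (fst z) / h) (\<lambda>z. rc x (fst z)) (at_right 0)"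
    by (rule uniform_limit_compose') auto
  have f: "uniform_limit ?S (\<lambda>h (u, \<xi>). (f h x u \<xi> - x) /\<^sub>R h) (\<lambda>(u, \<xi>). fc x u \<xi>) (at_right 0)"
    using disc U unfolding discretizes_def by blast
  have Q: "uniform_limit ?S ?q ?Q (at_right 0)"
    by (rule uniform_limit_difference_quotient[OF V[unfolded gderiv_def] f bdd[OF U]])
  have bQ: "bounded (?Q ` ?S)"
    using bounded_linear_image[OF bdd[OF U] bounded_linear_inner_left[of D]]
    by (simp add: image_image)
  have e0: "((\<lambda>h. exp (- \<rho> * h)) \<longlongrightarrow> 1) (at_right 0)"
    by (auto intro!: tendsto_eq_intros)
  then have e: "uniform_limit ?S (\<lambda>h z. exp (- \<rho> * h)) (\<lambda>z. 1) (at_right 0)"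
    unfolding uniform_limit_iff tendsto_iff by (auto elim: eventually_mono)
  have "((\<lambda>h. exp (- \<rho> * h)) has_real_derivative - \<rho>) (at 0)"
    by (auto intro!: derivative_eq_intros)
  then have "((\<lambda>h. (exp (- \<rho> * h) - 1) / h) \<longlongrightarrow> - \<rho>) (at_right 0)"
    by (auto simp: has_field_derivative_iff intro: filterlim_at_split[THEN iffD1, THEN conjunct2])
  then have "((\<lambda>h. (exp (- \<rho> * h) - 1) / h * V x) \<longlongrightarrow> - \<rho> * V x) (at_right 0)"
    by (intro tendsto_intros)
  then have c: "uniform_limit ?S (\<lambda>h z. (exp (- \<rho> * h) - 1) / h * V x) (\<lambda>z. - \<rho> * V x) (at_right 0)"
    unfolding uniform_limit_iff tendsto_iff by (auto elim: eventually_mono)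
  \<comment> \<open>Products preserve uniform limits when both limit functions are bounded, hence
    \<open>bQ\<close>.\<close>
  have "uniform_limit ?S (\<lambda>h z. exp (- \<rho> * h) * ?q h z) (\<lambda>z. 1 * ?Q z) (at_right 0)"
    by (rule uniform_lim_mult[OF e Q _ bQ]) (auto simp: image_constant_conv)
  then have lim: "uniform_limit ?S
      (\<lambda>h z. r h x (fst z) / h + exp (- \<rho> * h) * ?q h z + (exp (- \<rho> * h) - 1) / h * V x)
      (\<lambda>z. rc x (fst z) + 1 * ?Q z + - \<rho> * V x) (at_right 0)"
    by (intro uniform_limit_add r c)
  show "uniform_limit ?S (\<lambda>h (u, \<xi>). (lookahead r f \<rho> V h x u \<xi> - V x) / h)
      (\<lambda>(u, \<xi>). rc x u + D \<bullet> fc x u \<xi> - \<rho> * V x) (at_right 0)"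
  proof (rule uniform_limit_cong[THEN iffD1, OF _ _ lim])
    show "\<forall>\<^sub>F h in at_right 0. \<forall>z\<in>?S.
        r h x (fst z) / h + exp (- \<rho> * h) * ?q h z + (exp (- \<rho> * h) - 1) / h * V x =
        (case z of (u, \<xi>) \<Rightarrow> (lookahead r f \<rho> V h x u \<xi> - V x) / h)"
      using eventually_at_right_less[of "0::real"]
      by eventually_elim (auto simp: lookahead_def field_simps)
  qed (auto simp: inner_commute)
qed

text \<open>Uniform convergence over the singleton action set \<open>{u}\<close> gives pointwise
  limits, which are unique. Hence the choice of \<open>J\<close> in \<open>ct_optimal\<close> does
  not matter on \<open>\<Omega>\<close>.\<close>

lemma ct_limit_objective_unique:
  assumes "ct_limit_objective \<Omega> r f \<rho> V x J" "ct_limit_objective \<Omega> r f \<rho> V x J'" "\<xi> \<in> \<Omega>"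
  shows "J u \<xi> = J' u \<xi>"
proof -
  have "((\<lambda>h. (lookahead r f \<rho> V h x u \<xi> - V x) / h) \<longlongrightarrow> I u \<xi>) (at_right 0)"
    if "ct_limit_objective \<Omega> r f \<rho> V x I" for I
    using that \<open>\<xi> \<in> \<Omega>\<close> unfolding ct_limit_objective_def
    by (auto dest!: spec[of _ "{u}"] tendsto_uniform_limitI[where x = "(u, \<xi>)"])
  then show ?thesis using assms tendsto_unique trivial_limit_at_right_real by blast
qed

lemma bounded_action_disturbed_dynamics:
  assumes "bounded U"
  shows "bounded ((\<lambda>(u, \<xi>). action_disturbed_dynamics a B \<theta> x u \<xi>) ` (U \<times> energy_set \<alpha>))"
proof -
  have "bounded (energy_set \<alpha>)"
    by (auto simp: energy_set_def bounded_iff)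
  then have "bounded ((\<lambda>(u, \<xi>). u + \<xi>) ` (U \<times> energy_set \<alpha>))"
    using assms by (rule bounded_plus[rotated])
  then have "bounded ((*v) (B x \<theta>) ` (\<lambda>(u, \<xi>). u + \<xi>) ` (U \<times> energy_set \<alpha>))"
    by (rule bounded_linear_image) (rule matrix_vector_mul_bounded_linear)
  then have "bounded ((+) (a x \<theta>) ` (*v) (B x \<theta>) ` (\<lambda>(u, \<xi>). u + \<xi>) ` (U \<times> energy_set \<alpha>))"
    by (rule bounded_translation)
  then show ?thesis
    by (simp add: image_image case_prod_beta action_disturbed_dynamics_def)
qed

section \<open>Optimal policy and worst disturbance in closed form\<close>

theorem theorem2:
  fixes a :: "real^'n \<Rightarrow> 'p \<Rightarrow> real^'n"
    and B :: "real^'n \<Rightarrow> 'p \<Rightarrow> real^'m^'n"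
    and \<theta> :: 'p
    and q V :: "real^'n \<Rightarrow> real"
    and g :: "real^'m \<Rightarrow> real"
    and \<rho> \<alpha> :: real
    and r :: "real \<Rightarrow> real^'n \<Rightarrow> real^'m \<Rightarrow> real"
    and f :: "real \<Rightarrow> real^'n \<Rightarrow> real^'m \<Rightarrow> real^'m \<Rightarrow> real^'n"
  assumes "\<rho> > 0" and "\<alpha> \<ge> 0"
    and "positive_definite g" and "strictly_convex g"
    and "\<forall>u. g differentiable (at u)" and "bij (gradient g)"
    and "\<forall>x. V differentiable (at x)"
    and "discretizes (energy_set \<alpha>) (separable_reward q g) (action_disturbed_dynamics a B \<theta>) r f"
  shows "let w = (\<lambda>x. transpose (B x \<theta>) *v gradient V x);
             \<pi> = (\<lambda>x. gradient (convex_conjugate g) (w x));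
             \<xi> = (\<lambda>x. - \<alpha> *\<^sub>R (w x /\<^sub>R norm (w x)))
         in ct_optimal (energy_set \<alpha>) r f \<rho> V \<pi> \<xi> \<and>
            (\<forall>\<pi>' \<xi>'. ct_optimal (energy_set \<alpha>) r f \<rho> V \<pi>' \<xi>' \<longrightarrow>
               \<pi>' = \<pi> \<and> (\<forall>x. w x \<noteq> 0 \<longrightarrow> \<xi>' x = \<xi> x))"
proof -
  let ?\<Omega> = "energy_set \<alpha> :: (real^'m) set"
  define w where "w x = transpose (B x \<theta>) *v gradient V x" for x
  define \<pi> where "\<pi> x = gradient (convex_conjugate g) (w x)" for x
  define \<xi> where "\<xi> x = - \<alpha> *\<^sub>R (w x /\<^sub>R norm (w x))" for x
  \<comment> \<open>The Hamiltonian of the discounted problem, shifted by the state-dependent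
    constant \<open>\<rho> * V x\<close>.\<close>
  define J where "J x u \<xi> = separable_reward q g x u +
    gradient V x \<bullet> action_disturbed_dynamics a B \<theta> x u \<xi> - \<rho> * V x" for x u \<xi>
  have lim: "ct_limit_objective ?\<Omega> r f \<rho> V x (J x)" for x
    unfolding J_def using assms
    by (intro ct_limit_objective_discretizes GDERIV_gradient bounded_action_disturbed_dynamics) auto
  \<comment> \<open>First-order optimality of the policy: a preimage of \<open>w x\<close> under the
    gradient of \<open>g\<close> is also the gradient of the conjugate at
    \<open>w x\<close>.\<close>
  have \<pi>: "GDERIV g (\<pi> x) :> w x" for x
  proof -
    obtain u where "gradient g u = w x"
      using \<open>bij (gradient g)\<close> by (metis bij_pointE)
    then have u: "GDERIV g u :> w x"
      using assms GDERIV_gradient by metis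
    then have "GDERIV (convex_conjugate g) (w x) :> u"
      using assms by (intro GDERIV_convex_conjugate) (auto simp: bij_is_surj)
    then have "\<pi> x = u" unfolding \<pi>_def by (rule gradient_eqI)
    with u show ?thesis by simp
  qed
  \<comment> \<open>Stated for an arbitrary limit objective \<open>I\<close>, since a competing
    optimal pair may come with its own.\<close>
  have maxmin: "solves_maxmin ?\<Omega> I u \<zeta> \<longleftrightarrow>
      u = \<pi> x \<and> \<zeta> \<in> ?\<Omega> \<and> w x \<bullet> \<zeta> = - (\<alpha> * norm (w x))"
    if "ct_limit_objective ?\<Omega> r f \<rho> V x I" for x I u \<zeta>
  proof (rule solves_maxmin_decoupled[OF \<open>strictly_convex g\<close> \<pi> \<open>\<alpha> \<ge> 0\<close>])
    fix u \<zeta> assume "\<zeta> \<in> ?\<Omega>"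
    then have "I u \<zeta> = J x u \<zeta>" by (rule ct_limit_objective_unique[OF that lim])
    \<comment> \<open>Moving \<open>B x \<theta>\<close> across the inner product as its transpose
      produces \<open>w x\<close>.\<close>
    moreover have "gradient V x \<bullet> (B x \<theta> *v (u + \<zeta>)) = w x \<bullet> (u + \<zeta>)"
      unfolding w_def by (simp add: dot_lmul_matrix)
    ultimately show "I u \<zeta> = (q x + gradient V x \<bullet> a x \<theta> - \<rho> * V x) + (w x \<bullet> u - g u) + w x \<bullet> \<zeta>"
      by (simp add: J_def separable_reward_def action_disturbed_dynamics_def inner_add_right)
  qed
  have "ct_optimal ?\<Omega> r f \<rho> V \<pi> \<xi>"
    unfolding ct_optimal_def using lim maxmin[OF lim] worst_disturbance[OF \<open>\<alpha> \<ge> 0\<close>]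
    unfolding \<xi>_def by blast
  moreover have "\<pi>' = \<pi> \<and> (\<forall>x. w x \<noteq> 0 \<longrightarrow> \<xi>' x = \<xi> x)" if "ct_optimal ?\<Omega> r f \<rho> V \<pi>' \<xi>'" for \<pi>' \<xi>'
  proof -
    have "\<pi>' x = \<pi> x \<and> \<xi>' x \<in> ?\<Omega> \<and> w x \<bullet> \<xi>' x = - (\<alpha> * norm (w x))" for x
      using that maxmin unfolding ct_optimal_def by blast
    then show ?thesis
      using worst_disturbance_unique[OF _ \<open>\<alpha> \<ge> 0\<close>] unfolding \<xi>_def by blast
  qed
  ultimately show ?thesis
    unfolding Let_def w_def \<pi>_def \<xi>_def by blast
qed

end
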